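(* For each $n\in N$ and each $y\in\mathcal{Y}$ let $\mathcal{D}_n\rfloor y$ be a coherent set of desirable gambles on $\mathcal{X}_n$; write $\mathcal{D}_n\rfloor Y$ for the family $(\mathcal{D}_n\rfloor y)_{y\in\mathcal{Y}}$. Then the smallest conditionally independent product $\mathcal{D}\rfloor Y$ of the marginal models $\mathcal{D}_n\rfloor Y$, $n\in N$, is given by $\otimes_{n\in N}(\mathcal{D}_n\rfloor Y)$, meaning that for each $y\in\mathcal{Y}$, $\mathcal{D}\rfloor y=\otimes_{n\in N}(\mathcal{D}_n\rfloor y)$.
   Context: Let $N$ be a finite non-empty index set, for each $n\in N$ let $\mathcal{X}_n$ be a finite non-empty set, and let $\mathcal{Y}$ be a finite non-empty set (the values of a conditioning variable $Y$). For $R\subseteq N$ let $\mathcal{X}_R:=\prod_{r\in R}\mathcal{X}_r$, with $\mathcal{X}_\emptyset$ a one-point set. Subsets of $N$ are allowed to be empty. For a finite non-empty set $\mathcal{Z}$, a gamble on $\mathcal{Z}$ is a function $\mathcal{Z}\to\mathbb{R}$; $\mathcal{G}(\mathcal{Z})$ is the linear space of all gambles on $\mathcal{Z}$. Write $f\geq g$ for pointwise inequality and $f>g$ if $f\geq g$ and $f\neq g$; $\mathcal{G}(\mathcal{Z})_{>0}:=\{f\in\mathcal{G}(\mathcal{Z}):f>0\}$. For $\mathcal{A}\subseteq\mathcal{G}(\mathcal{Z})$, $\mathrm{posi}(\mathcal{A}):=\{\sum_{k=1}^{m}\lambda_kf_k : m\geq 1,\ f_k\in\mathcal{A},\ \lambda_k>0\}$.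 A set of desirable gambles $\mathcal{D}\subseteq\mathcal{G}(\mathcal{Z})$ is coherent if (D1) $0\notin\mathcal{D}$; (D2) $\mathcal{G}(\mathcal{Z})_{>0}\subseteq\mathcal{D}$; (D3) $\mathrm{posi}(\mathcal{D})=\mathcal{D}$. For $R\subseteq S\subseteq N$, a gamble $f$ on $\mathcal{X}_R$ is identified with its cylindrical extension $x_S\mapsto f(x_R)$ on $\mathcal{X}_S$; $\mathbb{I}_{\{x_R\}}$ denotes the indicator of $x_R\in\mathcal{X}_R$. For $O\subseteq S\subseteq N$ and $\mathcal{C}\subseteq\mathcal{G}(\mathcal{X}_S)$, $\mathrm{marg}_O(\mathcal{C}):=\mathcal{C}\cap\mathcal{G}(\mathcal{X}_O)$. For $I\subseteq S\subseteq N$ and $x_I\in\mathcal{X}_I$, $\mathcal{C}\rfloor x_I:=\{g\in\mathcal{G}(\mathcal{X}_{S\setminus I}):\mathbb{I}_{\{x_I\}}g\in\mathcal{C}\}$. A conditionally independent product of the families $\mathcal{D}_n\rfloor Y$, $n\in N$, is a family $\mathcal{D}\rfloor Y=(\mathcal{D}\rfloor y)_{y\in\mathcal{Y}}$ of coherent sets of desirable gambles on $\mathcal{X}_N$ such that for every $y\in\mathcal{Y}$: $\mathrm{marg}_{\{n\}}(\mathcal{D}\rfloor y)=\mathcal{D}_n\rfloor y$ for all $n\in N$, and $\mathrm{marg}_O((\mathcal{D}\rfloor y)\rfloor x_I)=\mathrm{marg}_O(\mathcal{D}\rfloor y)$ for all disjoint subsets $I,O$ of $N$ and all $x_I\in\mathcal{X}_I$.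 Families are ordered by inclusion for each $y\in\mathcal{Y}$. For coherent $\mathcal{C}_n\subseteq\mathcal{G}(\mathcal{X}_n)$, $n\in N$, $$\otimes_{n\in N}\mathcal{C}_n:=\mathrm{posi}\Big(\mathcal{G}(\mathcal{X}_N)_{>0}\cup\bigcup_{n\in N}\mathrm{posi}\left(\{\mathbb{I}_{\{x_{N\setminus\{n\}}\}}g : g\in\mathcal{C}_n,\ x_{N\setminus\{n\}}\in\mathcal{X}_{N\setminus\{n\}}\}\right)\Big).$$ *)

theory Defs
  imports Complex_Main "HOL-Library.FuncSet" "HOL-Library.Indicator_Function"
begin

section \<open>Coherent sets of desirable gambles\<close>

text \<open>
  A gamble on \<open>Z\<close> is represented by the total function that vanishes outside \<open>Z\<close>. Thus each
  gamble has exactly one representative, and the linear operations and the order on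
  \<open>gambles Z\<close> are the pointwise ones of the function type.
\<close>

definition gambles :: "'z set \<Rightarrow> ('z \<Rightarrow> real) set" where
  "gambles Z = {f. \<forall>z. z \<notin> Z \<longrightarrow> f z = 0}"

definition pos_gambles :: "'z set \<Rightarrow> ('z \<Rightarrow> real) set" where
  "pos_gambles Z = {f \<in> gambles Z. f > (\<lambda>_. 0)}"

definition posi :: "('z \<Rightarrow> real) set \<Rightarrow> ('z \<Rightarrow> real) set" where
  "posi A = {(\<lambda>z. \<Sum>k<m. c k * f k z) | (m :: nat) c f.
               m \<ge> 1 \<and> (\<forall>k<m. f k \<in> A \<and> c k > 0)}"

definition coherent :: "'z set \<Rightarrow> ('z \<Rightarrow> real) set \<Rightarrow> bool" where
  "coherent Z D \<longleftrightarrow>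
     D \<subseteq> gambles Z \<and> (\<lambda>_. 0) \<notin> D \<and> pos_gambles Z \<subseteq> D \<and> posi D = D"


section \<open>Marginals and conditioning on product spaces\<close>

text \<open>
  The space of joint values indexed by \<open>R\<close> is \<open>PiE R X\<close>; for \<open>R = {}\<close> it has exactly one
  element. All identifications of gambles on different spaces are made explicit:
  \<open>cyl X R S\<close> sends a gamble on \<open>PiE R X\<close> to its cylindrical extension to \<open>PiE S X\<close>, and
  \<open>local_gamble X n\<close> sends a gamble on \<open>X n\<close> to the corresponding gamble on \<open>PiE {n} X\<close>.
\<close>

definition cyl :: "('n \<Rightarrow> 'a set) \<Rightarrow> 'n set \<Rightarrow> 'n set \<Rightarrow>
    (('n \<Rightarrow> 'a) \<Rightarrow> real) \<Rightarrow> ('n \<Rightarrow> 'a) \<Rightarrow> real" where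
  "cyl X R S f = (\<lambda>x. if x \<in> PiE S X then f (restrict x R) else 0)"

definition local_gamble :: "('n \<Rightarrow> 'a set) \<Rightarrow> 'n \<Rightarrow> ('a \<Rightarrow> real) \<Rightarrow> ('n \<Rightarrow> 'a) \<Rightarrow> real" where
  "local_gamble X n f = (\<lambda>x. if x \<in> PiE {n} X then f (x n) else 0)"

text \<open>
  The product of the indicator of \<open>xI\<close>, a point of \<open>PiE I X\<close>, with a gamble \<open>g\<close> on
  \<open>PiE (S - I) X\<close>, as a gamble on \<open>PiE S X\<close>.
\<close>

definition ind_times :: "('n \<Rightarrow> 'a set) \<Rightarrow> 'n set \<Rightarrow> 'n set \<Rightarrow> ('n \<Rightarrow> 'a) \<Rightarrow>
    (('n \<Rightarrow> 'a) \<Rightarrow> real) \<Rightarrow> ('n \<Rightarrow> 'a) \<Rightarrow> real" where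
  "ind_times X S I xI g =
     (\<lambda>x. cyl X I S (indicator {xI}) x * cyl X (S - I) S g x)"

text \<open>
  In \<open>marg X S R C\<close> and \<open>conditional X S I xI C\<close>, \<open>C\<close> is a set of gambles on \<open>PiE S X\<close>.
\<close>

definition marg :: "('n \<Rightarrow> 'a set) \<Rightarrow> 'n set \<Rightarrow> 'n set \<Rightarrow>
    (('n \<Rightarrow> 'a) \<Rightarrow> real) set \<Rightarrow> (('n \<Rightarrow> 'a) \<Rightarrow> real) set" where
  "marg X S R C = {f \<in> gambles (PiE R X). cyl X R S f \<in> C}"

definition conditional :: "('n \<Rightarrow> 'a set) \<Rightarrow> 'n set \<Rightarrow> 'n set \<Rightarrow> ('n \<Rightarrow> 'a) \<Rightarrow>
    (('n \<Rightarrow> 'a) \<Rightarrow> real) set \<Rightarrow> (('n \<Rightarrow> 'a) \<Rightarrow> real) set" where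
  "conditional X S I xI C = {g \<in> gambles (PiE (S - I) X). ind_times X S I xI g \<in> C}"


section \<open>Conditionally independent products\<close>

text \<open>
  Only the values of the families at points of \<open>Y\<close> are relevant: \<open>Dn n y\<close> is the local model for
  \<open>n\<close> given \<open>y\<close>, and \<open>D y\<close> is the joint model given \<open>y\<close>.
\<close>

definition cond_indep_product :: "'n set \<Rightarrow> ('n \<Rightarrow> 'a set) \<Rightarrow> 'y set \<Rightarrow>
    ('n \<Rightarrow> 'y \<Rightarrow> ('a \<Rightarrow> real) set) \<Rightarrow> ('y \<Rightarrow> (('n \<Rightarrow> 'a) \<Rightarrow> real) set) \<Rightarrow> bool" where
  "cond_indep_product N X Y Dn D \<longleftrightarrow>
     (\<forall>y\<in>Y. coherent (PiE N X) (D y)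
        \<and> (\<forall>n\<in>N. marg X N {n} (D y) = local_gamble X n ` Dn n y)
        \<and> (\<forall>I R. I \<subseteq> N \<and> R \<subseteq> N \<and> I \<inter> R = {} \<longrightarrow>
             (\<forall>xI\<in>PiE I X.
                marg X (N - I) R (conditional X N I xI (D y)) = marg X N R (D y))))"

definition smallest_cond_indep_product :: "'n set \<Rightarrow> ('n \<Rightarrow> 'a set) \<Rightarrow> 'y set \<Rightarrow>
    ('n \<Rightarrow> 'y \<Rightarrow> ('a \<Rightarrow> real) set) \<Rightarrow> ('y \<Rightarrow> (('n \<Rightarrow> 'a) \<Rightarrow> real) set) \<Rightarrow> bool" where
  "smallest_cond_indep_product N X Y Dn D \<longleftrightarrow>
     cond_indep_product N X Y Dn D
     \<and> (\<forall>D'. cond_indep_product N X Y Dn D' \<longrightarrow> (\<forall>y\<in>Y. D y \<subseteq> D' y))"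

definition indep_ext :: "'n set \<Rightarrow> ('n \<Rightarrow> 'a set) \<Rightarrow> ('n \<Rightarrow> ('a \<Rightarrow> real) set) \<Rightarrow>
    (('n \<Rightarrow> 'a) \<Rightarrow> real) set" where
  "indep_ext N X C =
     posi (pos_gambles (PiE N X) \<union>
       (\<Union>n\<in>N. posi {ind_times X N (N - {n}) x (local_gamble X n g) | g x.
                       g \<in> C n \<and> x \<in> PiE (N - {n}) X}))"

end

theory Submission
  imports Defs
begin

text \<open>
  The extension of the local models to coordinates \<open>N\<close> restricts to the one on any \<open>R \<subseteq> N\<close>, even
  after conditioning on coordinates outside \<open>R\<close>. To see this, the coordinates outside \<open>R\<close> are
  eliminated one at a time: an element of the extension uses only finitely many gambles of \<open>C n\<close>,
  and separation gives strictly positive weights on \<open>X n\<close> making all their expectations positive.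
  Integrating coordinate \<open>n\<close> out against these weights turns the terms contributed by \<open>n\<close> into
  positive gambles and keeps the others in the extension over the remaining coordinates. Taking
  \<open>R = {}\<close> gives coherence, \<open>R = {n}\<close> the marginals, and general \<open>R\<close> independence. Minimality is
  immediate, since independence applied to \<open>I = N - {n}\<close> puts every generator into each product.
\<close>

section \<open>Positive hulls\<close>

lemma posi_inc: "f \<in> A \<Longrightarrow> f \<in> posi A"
  unfolding posi_def
  by (intro CollectI exI[of _ "1::nat"] exI[of _ "\<lambda>_. 1"] exI[of _ "\<lambda>_. f"]) auto

lemma posi_scale:
  assumes "f \<in> posi A" "(r::real) > 0"
  shows "(\<lambda>z. r * f z) \<in> posi A"
proof -
  obtain m :: nat and c F where "m \<ge> 1" "\<forall>k<m. F k \<in> A \<and> c k > 0" "f = (\<lambda>z. \<Sum>k<m. c k * F k z)"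
    using assms(1) unfolding posi_def by blast
  then show ?thesis unfolding posi_def using assms(2)
    by (intro CollectI exI[of _ m] exI[of _ "\<lambda>k. r * c k"] exI[of _ F])
       (auto simp: sum_distrib_left mult.assoc)
qed

lemma posi_add:
  assumes "f \<in> posi A" "g \<in> posi A"
  shows "(\<lambda>z. f z + g z) \<in> posi A"
proof -
  obtain m :: nat and c F where 1: "m \<ge> 1" "\<forall>k<m. F k \<in> A \<and> c k > 0" "f = (\<lambda>z. \<Sum>k<m. c k * F k z)"
    using assms(1) unfolding posi_def by blast
  obtain l :: nat and d G where 2: "l \<ge> 1" "\<forall>k<l. G k \<in> A \<and> d k > 0" "g = (\<lambda>z. \<Sum>k<l. d k * G k z)"
    using assms(2) unfolding posi_def by blast
  define e where "e k = (if k < m then c k else d (k - m))" for k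
  define H where "H k = (if k < m then F k else G (k - m))" for k
  have split: "(\<Sum>k<m + l. h k) = (\<Sum>k<m. h k) + (\<Sum>k<l. h (m + k))" for h :: "nat \<Rightarrow> real"
    by (induction l) auto
  have "(\<lambda>z. f z + g z) = (\<lambda>z. \<Sum>k<m + l. e k * H k z)"
    by (auto simp: 1 2 split e_def H_def)
  moreover have "\<forall>k<m + l. H k \<in> A \<and> e k > 0"
    using 1 2 by (auto simp: e_def H_def)
  ultimately show ?thesis unfolding posi_def using 1(1)
    by (intro CollectI exI[of _ "m + l"] exI[of _ e] exI[of _ H]) auto
qed

text \<open>Replaces indexed sums by closure under positive scaling and addition, so later arguments
  only treat generators and linearity.\<close>

lemma posi_induct [consumes 1, case_names base scale add]:
  assumes "f \<in> posi A"
    and base: "\<And>f. f \<in> A \<Longrightarrow> P f"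
    and scale: "\<And>f r. P f \<Longrightarrow> (r::real) > 0 \<Longrightarrow> P (\<lambda>z. r * f z)"
    and add: "\<And>f g. P f \<Longrightarrow> P g \<Longrightarrow> P (\<lambda>z. f z + g z)"
  shows "P f"
proof -
  obtain m :: nat and c F where 1: "m \<ge> 1" "\<forall>k<m. F k \<in> A \<and> c k > 0" "f = (\<lambda>z. \<Sum>k<m. c k * F k z)"
    using assms(1) unfolding posi_def by blast
  \<comment> \<open>Partial sums start with one term, because \<open>P\<close> need not hold for the
    empty sum 0; \<open>m \<ge> 1\<close> allows \<open>l = m - 1\<close> at the end.\<close>
  have "l < m \<Longrightarrow> P (\<lambda>z. \<Sum>k<Suc l. c k * F k z)" for l
  proof (induction l)
    case 0
    then have "P (\<lambda>z. c 0 * F 0 z)" using 1 by (intro scale base) auto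
    then show ?case by simp
  next
    case (Suc l)
    then have "P (\<lambda>z. (\<Sum>k<Suc l. c k * F k z) + c (Suc l) * F (Suc l) z)"
      using 1 by (intro add scale[OF base] Suc.IH) auto
    then show ?case by simp
  qed
  from this[of "m - 1"] show ?thesis using 1 by simp
qed

lemma posi_mono: "A \<subseteq> B \<Longrightarrow> posi A \<subseteq> posi B"
  unfolding posi_def by blast

lemma posi_posi: "posi (posi A) = posi A"
proof
  show "posi (posi A) \<subseteq> posi A"
  proof
    fix f assume "f \<in> posi (posi A)"
    then show "f \<in> posi A" by (induction rule: posi_induct) (auto intro: posi_scale posi_add)
  qed
qed (auto intro: posi_inc)

lemma coherent_scale: "coherent Z D \<Longrightarrow> f \<in> D \<Longrightarrow> (r::real) > 0 \<Longrightarrow> (\<lambda>z. r * f z) \<in> D"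
  unfolding coherent_def by (metis posi_scale)

lemma coherent_add: "coherent Z D \<Longrightarrow> f \<in> D \<Longrightarrow> g \<in> D \<Longrightarrow> (\<lambda>z. f z + g z) \<in> D"
  unfolding coherent_def by (metis posi_add)

lemma pos_gambles_iff:
  "f \<in> pos_gambles Z \<longleftrightarrow> (\<forall>z. z \<notin> Z \<longrightarrow> f z = 0) \<and> (\<forall>z\<in>Z. f z \<ge> 0) \<and> (\<exists>z\<in>Z. f z > 0)"
proof
  assume "f \<in> pos_gambles Z"
  then have *: "\<forall>z. z \<notin> Z \<longrightarrow> f z = 0" "\<forall>z. f z \<ge> 0" "\<not> (\<forall>z. f z \<le> 0)"
    by (auto simp: pos_gambles_def gambles_def less_fun_def le_fun_def)
  then obtain z where "f z > 0" by (auto simp: not_le)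
  then show "(\<forall>z. z \<notin> Z \<longrightarrow> f z = 0) \<and> (\<forall>z\<in>Z. f z \<ge> 0) \<and> (\<exists>z\<in>Z. f z > 0)"
    using * by (metis less_irrefl)
next
  assume *: "(\<forall>z. z \<notin> Z \<longrightarrow> f z = 0) \<and> (\<forall>z\<in>Z. f z \<ge> 0) \<and> (\<exists>z\<in>Z. f z > 0)"
  then have "\<forall>z. f z \<ge> 0" by (metis order_refl)
  with * show "f \<in> pos_gambles Z"
    by (auto simp: pos_gambles_def gambles_def less_fun_def le_fun_def not_le)
qed


section \<open>Separation\<close>

text \<open>Supplies the weight of the eliminated point in \<open>gordan\<close>, where there may be
  no lower bounds or no upper bounds.\<close>

lemma finite_between:
  fixes L U :: "real set"
  assumes "finite L" "finite U" "\<And>l u. l \<in> L \<Longrightarrow> u \<in> U \<Longrightarrow> l < u"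
  shows "\<exists>t. (\<forall>l\<in>L. l < t) \<and> (\<forall>u\<in>U. t < u)"
proof (cases "L = {} \<or> U = {}")
  case True
  then show ?thesis
  proof
    assume "L = {}"
    moreover have "\<exists>t. \<forall>u\<in>U. t < u"
    \<comment> \<open>The witness is \<open>Min U - 1\<close>; if \<open>U\<close> is empty too,
      \<open>Min U\<close> is unspecified but the claim is vacuous.\<close>
    proof (intro exI ballI)
      fix u assume "u \<in> U"
      then have "Min U \<le> u" using assms(2) by simp
      then show "Min U - 1 < u" by simp
    qed
    ultimately show ?thesis by auto
  next
    assume "U = {}"
    moreover have "\<exists>t. \<forall>l\<in>L. l < t"
    proof (intro exI ballI)
      fix l assume "l \<in> L"
      then have "l \<le> Max L" using assms(1) by simp
      then show "l < Max L + 1" by simp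
    qed
    ultimately show ?thesis by auto
  qed
next
  case False
  then have "Max L < Min U" using assms by simp
  then obtain t where "Max L < t" "t < Min U" using dense by blast
  then show ?thesis using assms False by auto
qed

text \<open>Gordan's alternative, by Fourier-Motzkin elimination of one weight at a time.\<close>

lemma gordan:
  assumes "finite Z" "finite B" "B \<subseteq> gambles Z" "(\<lambda>_. 0) \<notin> posi B"
  shows "\<exists>w. \<forall>g\<in>B. (\<Sum>z\<in>Z. w z * g z) > (0::real)"
  using assms
proof (induction Z arbitrary: B rule: finite_induct)
  case empty
  have "B = {}"
  proof (rule ccontr)
    assume "B \<noteq> {}"
    then obtain g where "g \<in> B" by blast
    moreover have "g = (\<lambda>_. 0)" using empty(2) \<open>g \<in> B\<close> by (auto simp: gambles_def)
    ultimately show False using empty(3) posi_inc by blast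
  qed
  then show ?case by simp
next
  case (insert x Z)
  define P where "P = {g \<in> B. g x > 0}"
  define Q where "Q = {g \<in> B. g x < 0}"
  \<comment> \<open>For \<open>g\<close> in \<open>P\<close> and \<open>h\<close> in
    \<open>Q\<close> both coefficients are positive and the values at \<open>x\<close> cancel. So
    \<open>elim (g, h)\<close> lies in \<open>posi B\<close> and is a gamble on
    \<open>Z\<close>.\<close>
  define elim where "elim = (\<lambda>(g, h) z. g x * h z + (- h x) * g z :: real)"
  define B' where "B' = {g \<in> B. g x = 0} \<union> elim ` (P \<times> Q)"
  have gZ: "g z = 0" if "g \<in> B" "z \<notin> insert x Z" for g z
    using insert.prems(2) that by (auto simp: gambles_def)
  have fin: "finite P" "finite Q" using insert.prems(1) by (auto simp: P_def Q_def)
  have "finite B'" using insert.prems(1) fin by (auto simp: B'_def)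
  moreover have "B' \<subseteq> gambles Z"
  proof
    fix k assume "k \<in> B'"
    then have "k x = 0" by (auto simp: B'_def elim_def)
    moreover have "k z = 0" if "z \<notin> insert x Z" for z
      using \<open>k \<in> B'\<close> that by (auto simp: B'_def elim_def P_def Q_def gZ)
    ultimately have "k z = 0" if "z \<notin> Z" for z
      using that by (cases "z = x") auto
    then show "k \<in> gambles Z" by (simp add: gambles_def)
  qed
  moreover have "(\<lambda>_. 0) \<notin> posi B'"
  proof -
    have "B' \<subseteq> posi B"
    proof
      fix k assume "k \<in> B'"
      then consider "k \<in> B" | g h where "g \<in> P" "h \<in> Q" "k = elim (g, h)" by (auto simp: B'_def)
      then show "k \<in> posi B"
      proof cases
        case 2
        then have "g \<in> posi B" "h \<in> posi B" "g x > 0" "- h x > 0"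
          by (auto simp: P_def Q_def intro: posi_inc)
        then show ?thesis
          using posi_add[OF posi_scale[of h B "g x"] posi_scale[of g B "- h x"]] 2(3)
          by (simp add: elim_def)
      qed (rule posi_inc)
    qed
    then have "posi B' \<subseteq> posi B" using posi_mono posi_posi by metis
    then show ?thesis using insert.prems(3) by blast
  qed
  ultimately have "\<exists>w. \<forall>g\<in>B'. (\<Sum>z\<in>Z. w z * g z) > 0" by (rule insert.IH)
  then obtain w where w: "\<And>g. g \<in> B' \<Longrightarrow> (\<Sum>z\<in>Z. w z * g z) > 0" by metis
  define s where "s g = (\<Sum>z\<in>Z. w z * g z)" for g
  \<comment> \<open>With weight \<open>t\<close> at \<open>x\<close> the sum for \<open>g\<close>
    becomes \<open>t * g x + s g\<close>. Its positivity bounds \<open>t\<close> below for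
    \<open>g\<close> in \<open>P\<close> and above for \<open>g\<close> in \<open>Q\<close>;
    positivity on \<open>elim (g, h)\<close> says exactly that each lower bound is below each upper
    bound.\<close>
  have "\<exists>t. (\<forall>l\<in>(\<lambda>g. - s g / g x) ` P. l < t) \<and> (\<forall>u\<in>(\<lambda>h. - s h / h x) ` Q. t < u)"
  proof (intro finite_between finite_imageI fin)
    fix l u assume "l \<in> (\<lambda>g. - s g / g x) ` P" "u \<in> (\<lambda>h. - s h / h x) ` Q"
    then obtain g h where gh: "g \<in> P" "l = - s g / g x" "h \<in> Q" "u = - s h / h x" by auto
    then have "s (elim (g, h)) > 0" using w[of "elim (g, h)"] by (auto simp: B'_def s_def)
    moreover have "s (elim (g, h)) = g x * s h - h x * s g"
      by (simp add: s_def elim_def algebra_simps sum.distrib sum_distrib_left sum_subtractf)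
    \<comment> \<open>Numerator and denominator are both negative; the quotient is
      \<open>u - l\<close>.\<close>
    ultimately have "(h x * s g - g x * s h) / (g x * h x) > 0"
      using gh(1,3) by (intro divide_neg_neg mult_pos_neg) (auto simp: P_def Q_def)
    moreover have "u - l = (h x * s g - g x * s h) / (g x * h x)"
      using gh(1,3) unfolding gh(2,4) by (simp add: P_def Q_def field_simps)
    ultimately show "l < u" by simp
  qed
  then obtain t where t1: "\<And>g. g \<in> P \<Longrightarrow> - s g / g x < t" and t2: "\<And>h. h \<in> Q \<Longrightarrow> t < - s h / h x"
    by auto
  have "(\<Sum>z\<in>insert x Z. (w(x := t)) z * g z) > 0" if "g \<in> B" for g
  proof -
    have "(\<Sum>z\<in>Z. (w(x := t)) z * g z) = s g"
      unfolding s_def using insert.hyps(2) by (intro sum.cong) auto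
    then have eq: "(\<Sum>z\<in>insert x Z. (w(x := t)) z * g z) = t * g x + s g"
      using insert.hyps by simp
    consider "g x = 0" | "g x > 0" | "g x < 0" by linarith
    then show ?thesis
    proof cases
      case 1
      then show ?thesis using w[of g] that eq by (simp add: B'_def s_def)
    next
      case 2
      then show ?thesis using t1[of g] that eq by (auto simp: P_def field_simps)
    next
      case 3
      then show ?thesis using t2[of g] that eq by (auto simp: Q_def field_simps)
    qed
  qed
  then show ?case by blast
qed

text \<open>The positive hull of a finite part of \<open>C\<close> stays in \<open>C\<close> and
  hence avoids 0, so \<open>gordan\<close> applies. Adjoining the point indicators, which lie in
  \<open>C\<close> as positive gambles, forces every weight to be strictly positive.\<close>

lemma coherent_separation:
  assumes "finite Z" "coherent Z C" "finite A" "A \<subseteq> C"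
  shows "\<exists>p. (\<forall>z\<in>Z. p z > (0::real)) \<and> (\<forall>g\<in>A. (\<Sum>z\<in>Z. p z * g z) > 0)"
proof -
  let ?B = "A \<union> (\<lambda>a. indicator {a}) ` Z"
  have C: "C \<subseteq> gambles Z" "(\<lambda>_. 0) \<notin> C" "pos_gambles Z \<subseteq> C" "posi C = C"
    using assms(2) by (auto simp: coherent_def)
  have "indicator {a} \<in> pos_gambles Z" if "a \<in> Z" for a
    using that by (auto simp: pos_gambles_iff indicator_def)
  then have "?B \<subseteq> C" using assms(4) C(3) by auto
  moreover from this have "(\<lambda>_. 0) \<notin> posi ?B" using posi_mono[of ?B C] C(2,4) by blast
  moreover have "finite ?B" using assms(1,3) by simp
  ultimately have "\<exists>w. \<forall>g\<in>?B. (\<Sum>z\<in>Z. w z * g z) > (0::real)"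
    using gordan[OF assms(1) \<open>finite ?B\<close> order_trans[OF _ C(1)]] by simp
  then obtain w where w: "\<And>g. g \<in> ?B \<Longrightarrow> (\<Sum>z\<in>Z. w z * g z) > (0::real)"
    by metis
  have "w a > 0" if "a \<in> Z" for a
  proof -
    have "(\<Sum>z\<in>Z. w z * indicator {a} z) = (\<Sum>z\<in>Z. if z = a then w a else 0)"
      by (intro sum.cong) auto
    also have "\<dots> = w a" using that assms(1) by simp
    finally show ?thesis using w[of "indicator {a}"] that by simp
  qed
  then show ?thesis using w by blast
qed


section \<open>The independent natural extension\<close>

text \<open>The generators of \<open>indep_ext\<close> written pointwise, free of nested cylindrical
  extensions.\<close>

definition slice_gamble :: "('n \<Rightarrow> 'a set) \<Rightarrow> 'n set \<Rightarrow> 'n \<Rightarrow> ('n \<Rightarrow> 'a) \<Rightarrow> ('a \<Rightarrow> real) \<Rightarrow> ('n \<Rightarrow> 'a) \<Rightarrow> real"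
  where "slice_gamble X N n x g = (\<lambda>z. if z \<in> PiE N X \<and> (\<forall>i\<in>N - {n}. z i = x i) then g (z n) else 0)"

lemma restrict_eq_iff:
  assumes "x \<in> PiE I X"
  shows "restrict z I = x \<longleftrightarrow> (\<forall>i\<in>I. z i = x i)"
  using assms by (auto simp: fun_eq_iff restrict_def PiE_def extensional_def)

lemma ind_times_local_gamble:
  assumes "n \<in> N" "x \<in> PiE (N - {n}) X"
  shows "ind_times X N (N - {n}) x (local_gamble X n g) = slice_gamble X N n x g"
proof
  fix z
  have *: "N - (N - {n}) = {n}" using assms(1) by auto
  show "ind_times X N (N - {n}) x (local_gamble X n g) z = slice_gamble X N n x g z"
  proof (cases "z \<in> PiE N X")
    case True
    then have "restrict z {n} \<in> PiE {n} X" using assms(1) by auto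
    then show ?thesis using True restrict_eq_iff[OF assms(2), of z]
      by (simp add: ind_times_def cyl_def slice_gamble_def local_gamble_def * indicator_def)
  qed (simp add: ind_times_def cyl_def slice_gamble_def)
qed

lemma indep_ext_pos: "f \<in> pos_gambles (PiE N X) \<Longrightarrow> f \<in> indep_ext N X C"
  unfolding indep_ext_def by (auto intro: posi_inc)

lemma indep_ext_slice:
  assumes "n \<in> N" "x \<in> PiE (N - {n}) X" "g \<in> C n"
  shows "slice_gamble X N n x g \<in> indep_ext N X C"
  unfolding indep_ext_def ind_times_local_gamble[OF assms(1,2), symmetric]
  using assms by (intro posi_inc UnI2 UN_I[of n]) auto

lemma indep_ext_scale: "f \<in> indep_ext N X C \<Longrightarrow> r > 0 \<Longrightarrow> (\<lambda>z. r * f z) \<in> indep_ext N X C"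
  unfolding indep_ext_def by (rule posi_scale)

lemma indep_ext_add:
  "f \<in> indep_ext N X C \<Longrightarrow> g \<in> indep_ext N X C \<Longrightarrow> (\<lambda>z. f z + g z) \<in> indep_ext N X C"
  unfolding indep_ext_def by (rule posi_add)

lemma indep_ext_scale_iff:
  assumes "r > 0"
  shows "(\<lambda>z. r * f z) \<in> indep_ext N X C \<longleftrightarrow> f \<in> indep_ext N X C"
  using indep_ext_scale[of "\<lambda>z. r * f z" N X C "1 / r"] indep_ext_scale[of f N X C r] assms by auto

lemma indep_ext_sum:
  assumes "finite A" "A \<noteq> {}" "\<And>a. a \<in> A \<Longrightarrow> f a \<in> indep_ext N X C"
  shows "(\<lambda>z. \<Sum>a\<in>A. f a z) \<in> indep_ext N X C"
  using assms by (induction A rule: finite_ne_induct) (auto intro: indep_ext_add)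

text \<open>Two rounds of \<open>posi_induct\<close>, for the outer and the inner hull, flatten the
  nested definition to positive gambles and slices.\<close>

lemma indep_ext_induct [consumes 1, case_names pos slice scale add]:
  assumes "f \<in> indep_ext N X C"
    and pos: "\<And>f. f \<in> pos_gambles (PiE N X) \<Longrightarrow> P f"
    and slice: "\<And>n x g. n \<in> N \<Longrightarrow> x \<in> PiE (N - {n}) X \<Longrightarrow> g \<in> C n \<Longrightarrow> P (slice_gamble X N n x g)"
    and scale: "\<And>f r. P f \<Longrightarrow> (r::real) > 0 \<Longrightarrow> P (\<lambda>z. r * f z)"
    and add: "\<And>f g. P f \<Longrightarrow> P g \<Longrightarrow> P (\<lambda>z. f z + g z)"
  shows "P f"
  using assms(1) unfolding indep_ext_def
proof (induction rule: posi_induct)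
  case (base f)
  then show ?case
  proof
    assume "f \<in> (\<Union>n\<in>N. posi {ind_times X N (N - {n}) x (local_gamble X n g) | g x.
                       g \<in> C n \<and> x \<in> PiE (N - {n}) X})"
    then obtain n where n: "n \<in> N" "f \<in> posi {ind_times X N (N - {n}) x (local_gamble X n g) | g x.
                       g \<in> C n \<and> x \<in> PiE (N - {n}) X}" by blast
    show ?thesis using n(2)
    proof (induction rule: posi_induct)
      case (base f)
      then show ?case using n(1) slice by (auto simp: ind_times_local_gamble)
    qed (auto intro: scale add)
  qed (rule pos)
qed (auto intro: scale add)

lemma indep_ext_gambles: "f \<in> indep_ext N X C \<Longrightarrow> f \<in> gambles (PiE N X)"
  by (induction rule: indep_ext_induct)
     (auto simp: pos_gambles_def slice_gamble_def gambles_def)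


section \<open>Adding and eliminating coordinates\<close>

text \<open>Covers cylindrical extension (\<open>I = {}\<close>) and multiplication by an indicator
  in one operator, so marginals before and after conditioning are handled together. Only the values
  of \<open>u\<close> on \<open>I\<close> matter, so \<open>u\<close> can stay fixed while
  \<open>I\<close> shrinks.\<close>

definition slab :: "('n \<Rightarrow> 'a set) \<Rightarrow> 'n set \<Rightarrow> 'n set \<Rightarrow> ('n \<Rightarrow> 'a) \<Rightarrow> 'n set \<Rightarrow>
    (('n \<Rightarrow> 'a) \<Rightarrow> real) \<Rightarrow> ('n \<Rightarrow> 'a) \<Rightarrow> real"
  where "slab X S I u R f = (\<lambda>z. if z \<in> PiE S X \<and> (\<forall>i\<in>I. z i = u i) then f (restrict z R) else 0)"

definition integrate_out :: "('n \<Rightarrow> 'a set) \<Rightarrow> 'n \<Rightarrow> 'n set \<Rightarrow> ('a \<Rightarrow> real) \<Rightarrow>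
    (('n \<Rightarrow> 'a) \<Rightarrow> real) \<Rightarrow> ('n \<Rightarrow> 'a) \<Rightarrow> real"
  where "integrate_out X n S p h = (\<lambda>z. if z \<in> PiE S X then \<Sum>a\<in>X n. p a * h (z(n := a)) else 0)"

lemma PiE_insert_upd: "z \<in> PiE S X \<Longrightarrow> a \<in> X n \<Longrightarrow> z(n := a) \<in> PiE (insert n S) X"
  by (auto simp: PiE_def extensional_def)

lemma PiE_insert_restrict: "z \<in> PiE (insert n S) X \<Longrightarrow> restrict z S \<in> PiE S X"
  by auto

lemma restrict_upd_notin:
  assumes "z \<in> PiE S X" "n \<notin> S"
  shows "restrict (z(n := a)) S = z"
  using assms by (auto simp: fun_eq_iff restrict_def PiE_def extensional_def)

text \<open>Multiplication by the indicator of the event that coordinate \<open>n\<close> equals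
  \<open>a\<close> is linear, keeps positive gambles positive, and sends the slice at
  \<open>x\<close> to the slice at \<open>x(n := a)\<close>.\<close>

lemma indep_ext_extend:
  assumes "n \<notin> S" "a \<in> X n" "f \<in> indep_ext S X C"
  shows "slab X (insert n S) {n} (\<lambda>_. a) S f \<in> indep_ext (insert n S) X C"
  using assms(3)
proof (induction rule: indep_ext_induct)
  case (pos f)
  then obtain z where z: "z \<in> PiE S X" "f z > 0" by (auto simp: pos_gambles_iff)
  show ?case
  proof (rule indep_ext_pos, unfold pos_gambles_iff, intro conjI)
    show "\<exists>z\<in>PiE (insert n S) X. slab X (insert n S) {n} (\<lambda>_. a) S f z > 0"
      using z assms PiE_insert_upd[of z S X a n] restrict_upd_notin[of z S X n a]
      by (intro bexI[of _ "z(n := a)"]) (auto simp: slab_def)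
    show "\<forall>z\<in>PiE (insert n S) X. slab X (insert n S) {n} (\<lambda>_. a) S f z \<ge> 0"
      using pos PiE_insert_restrict[of _ n S X] by (auto simp: pos_gambles_iff slab_def)
  qed (auto simp: slab_def)
next
  case (slice m x g)
  then have mn: "m \<noteq> n" using assms(1) by auto
  have "slab X (insert n S) {n} (\<lambda>_. a) S (slice_gamble X S m x g)
      = slice_gamble X (insert n S) m (x(n := a)) g"
  proof
    fix z
    show "slab X (insert n S) {n} (\<lambda>_. a) S (slice_gamble X S m x g) z
        = slice_gamble X (insert n S) m (x(n := a)) g z"
    proof (cases "z \<in> PiE (insert n S) X")
      case True
      then have r: "restrict z S \<in> PiE S X" by auto
      have "(\<forall>i\<in>insert n S - {m}. z i = (x(n := a)) i) \<longleftrightarrow> z n = a \<and> (\<forall>i\<in>S - {m}. z i = x i)"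
        using mn assms(1) by auto
      then show ?thesis using True r slice(1) by (auto simp: slab_def slice_gamble_def)
    qed (simp add: slab_def slice_gamble_def)
  qed
  moreover have "x(n := a) \<in> PiE (insert n S - {m}) X"
    using PiE_insert_upd[OF slice(2) assms(2)] mn by (simp add: insert_Diff_if)
  ultimately show ?case using slice by (auto intro: indep_ext_slice)
next
  case (scale f r)
  have "slab X (insert n S) {n} (\<lambda>_. a) S (\<lambda>z. r * f z)
      = (\<lambda>z. r * slab X (insert n S) {n} (\<lambda>_. a) S f z)" by (auto simp: slab_def)
  then show ?case using scale by (simp add: indep_ext_scale)
next
  case (add f g)
  have "slab X (insert n S) {n} (\<lambda>_. a) S (\<lambda>z. f z + g z)
      = (\<lambda>z. slab X (insert n S) {n} (\<lambda>_. a) S f z + slab X (insert n S) {n} (\<lambda>_. a) S g z)"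
    by (auto simp: slab_def)
  then show ?case using add by (simp add: indep_ext_add)
qed

text \<open>
  Collecting finitely many constraints on \<open>p\<close> first, instead of choosing \<open>p\<close> at once, is what
  makes the claim stable under sums.
\<close>

lemma indep_ext_integrate_out_finite:
  assumes "n \<notin> S" "finite (X n)" "X n \<noteq> {}" "h \<in> indep_ext (insert n S) X C"
  shows "\<exists>A. finite A \<and> A \<subseteq> C n \<and>
    (\<forall>p. (\<forall>a\<in>X n. p a > 0) \<and> (\<forall>g\<in>A. (\<Sum>a\<in>X n. p a * g a) > 0) \<longrightarrow>
      integrate_out X n S p h \<in> indep_ext S X C)"
  using assms(4)
proof (induction rule: indep_ext_induct)
  case (pos f)
  then obtain z where z: "z \<in> PiE (insert n S) X" "f z > 0" by (auto simp: pos_gambles_iff)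
  have nn: "f y \<ge> 0" for y using pos unfolding pos_gambles_iff by (metis order_refl)
  have "integrate_out X n S p f \<in> indep_ext S X C" if p: "\<forall>a\<in>X n. p a > 0" for p
  proof (rule indep_ext_pos, unfold pos_gambles_iff, intro conjI)
    \<comment> \<open>The sum at \<open>restrict z S\<close> thus contains the strictly positive
      term \<open>p (z n) * f z\<close>.\<close>
    have zz: "(restrict z S)(n := z n) = z"
      using z(1) assms(1) by (auto simp: fun_eq_iff restrict_def PiE_def extensional_def)
    have "(\<Sum>a\<in>X n. p a * f ((restrict z S)(n := a))) > 0"
    proof (rule sum_pos2[of _ "z n"])
      show "z n \<in> X n" using z(1) by auto
      then show "p (z n) * f ((restrict z S)(n := z n)) > 0" using p z(2) by (simp only: zz) simp
    qed (use assms(2) p nn in \<open>auto simp: less_imp_le\<close>)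
    then show "\<exists>y\<in>PiE S X. integrate_out X n S p f y > 0"
      using PiE_insert_restrict[OF z(1)] by (intro bexI[of _ "restrict z S"]) (auto simp: integrate_out_def)
    show "\<forall>y\<in>PiE S X. integrate_out X n S p f y \<ge> 0"
      using p nn by (auto simp: integrate_out_def less_imp_le intro!: sum_nonneg)
  qed (simp add: integrate_out_def)
  then show ?case by (intro exI[of _ "{}"]) auto
next
  case (slice m x g)
  show ?case
  \<comment> \<open>If the slice belongs to the coordinate being integrated out, what remains is the
    indicator of \<open>x\<close> times the expectation of \<open>g\<close>. This is a positive
    gamble once \<open>g\<close> is among the constraints on \<open>p\<close>.\<close>
  proof (cases "m = n")
    case True
    then have x: "x \<in> PiE S X" using slice(2) assms(1) by simp
    have "integrate_out X n S p (slice_gamble X (insert n S) m x g) \<in> indep_ext S X C"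
      if p: "(\<Sum>a\<in>X n. p a * g a) > 0" for p
    proof -
      have eq: "integrate_out X n S p (slice_gamble X (insert n S) m x g)
          = (\<lambda>z. if z = x then \<Sum>a\<in>X n. p a * g a else 0)"
      proof
        fix z
        have "(\<forall>i\<in>S. z i = x i) \<longleftrightarrow> z = x" if "z \<in> PiE S X"
          using PiE_ext[OF that x] by auto
        moreover have "(\<forall>i\<in>insert n S - {n}. (z(n := a)) i = x i) \<longleftrightarrow> (\<forall>i\<in>S. z i = x i)" for a
          using assms(1) by auto
        ultimately show "integrate_out X n S p (slice_gamble X (insert n S) m x g) z
          = (if z = x then \<Sum>a\<in>X n. p a * g a else 0)"
          using x True PiE_insert_upd[of z S X _ n]
          by (auto simp: integrate_out_def slice_gamble_def intro!: sum.cong)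
      qed
      show ?thesis unfolding eq
        using x p by (intro indep_ext_pos) (auto simp: pos_gambles_iff)
    qed
    then show ?thesis using slice(3) True by (intro exI[of _ "{g}"]) auto
  next
    case False
    \<comment> \<open>Here \<open>n\<close> is one of the coordinates fixed by \<open>x\<close>.
      Only the summand \<open>a = x n\<close> survives, leaving a slice over \<open>S\<close> scaled
      by \<open>p (x n)\<close>; positivity of \<open>p\<close> suffices.\<close>
    then have m: "m \<in> S" and xn: "x n \<in> X n" using slice(1,2) by auto
    have x': "restrict x (S - {m}) \<in> PiE (S - {m}) X" using slice(2) by auto
    have "integrate_out X n S p (slice_gamble X (insert n S) m x g) \<in> indep_ext S X C"
      if p: "\<forall>a\<in>X n. p a > 0" for p
    proof -
      have "integrate_out X n S p (slice_gamble X (insert n S) m x g)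
          = (\<lambda>z. p (x n) * slice_gamble X S m (restrict x (S - {m})) g z)"
      proof
        fix z
        show "integrate_out X n S p (slice_gamble X (insert n S) m x g) z
            = p (x n) * slice_gamble X S m (restrict x (S - {m})) g z"
        proof (cases "z \<in> PiE S X")
          case True
          have "(\<forall>i\<in>insert n S - {m}. (z(n := a)) i = x i) \<longleftrightarrow> a = x n \<and> (\<forall>i\<in>S - {m}. z i = x i)" for a
            using assms(1) False by auto
          then have "(\<Sum>a\<in>X n. p a * slice_gamble X (insert n S) m x g (z(n := a)))
            = (\<Sum>a\<in>X n. if a = x n then p (x n) * slice_gamble X S m (restrict x (S - {m})) g z else 0)"
            using True PiE_insert_upd[OF True] False
            by (intro sum.cong) (auto simp: slice_gamble_def)
          then show ?thesis using True xn assms(2) by (simp add: integrate_out_def)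
        qed (simp add: integrate_out_def slice_gamble_def)
      qed
      then show ?thesis using p xn indep_ext_slice[where C = C, OF m x' slice(3)]
        by (simp add: indep_ext_scale)
    qed
    then show ?thesis by (intro exI[of _ "{}"]) auto
  qed
next
  case (scale f r)
  have "integrate_out X n S p (\<lambda>z. r * f z) = (\<lambda>z. r * integrate_out X n S p f z)" for p
    by (auto simp: integrate_out_def sum_distrib_left algebra_simps)
  then show ?case using scale by (simp add: indep_ext_scale_iff)
next
  case (add f g)
  have "integrate_out X n S p (\<lambda>z. f z + g z) = (\<lambda>z. integrate_out X n S p f z + integrate_out X n S p g z)" for p
    by (auto simp: integrate_out_def sum.distrib algebra_simps)
  moreover obtain A B where "finite A" "A \<subseteq> C n" "finite B" "B \<subseteq> C n"
    "\<forall>p. (\<forall>a\<in>X n. p a > 0) \<and> (\<forall>g\<in>A. (\<Sum>a\<in>X n. p a * g a) > 0) \<longrightarrow>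
      integrate_out X n S p f \<in> indep_ext S X C"
    "\<forall>p. (\<forall>a\<in>X n. p a > 0) \<and> (\<forall>g\<in>B. (\<Sum>a\<in>X n. p a * g a) > 0) \<longrightarrow>
      integrate_out X n S p g \<in> indep_ext S X C"
    using add by blast
  ultimately show ?case by (intro exI[of _ "A \<union> B"]) (auto intro: indep_ext_add)
qed

lemma indep_ext_integrate_out:
  assumes "n \<notin> S" "finite (X n)" "X n \<noteq> {}" "coherent (X n) (C n)" "h \<in> indep_ext (insert n S) X C"
  obtains p where "\<And>a. a \<in> X n \<Longrightarrow> p a > 0" "integrate_out X n S p h \<in> indep_ext S X C"
  using indep_ext_integrate_out_finite[where C = C, OF assms(1-3,5)] coherent_separation[OF assms(2,4)]
  by metis

text \<open>As \<open>R \<subseteq> S\<close>, the gamble \<open>f\<close> does not look at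
  coordinate \<open>n\<close>. Upwards, \<open>n\<close> is fixed at \<open>u n\<close> or summed
  over all its values; downwards, integrating \<open>n\<close> out returns the smaller slab times a
  positive constant.\<close>

lemma indep_ext_slab_step:
  assumes n: "n \<notin> S" "finite (X n)" "X n \<noteq> {}" "coherent (X n) (C n)"
    and "R \<subseteq> S" "I \<subseteq> insert n S" "u \<in> Pi I X"
  shows "slab X (insert n S) I u R f \<in> indep_ext (insert n S) X C
    \<longleftrightarrow> slab X S (I - {n}) u R f \<in> indep_ext S X C" (is "?h \<in> _ \<longleftrightarrow> ?k \<in> _")
proof
  assume "?k \<in> indep_ext S X C"
  note ext = indep_ext_extend[where X = X and n = n, OF n(1) _ this]
  have rr: "restrict (restrict z S) R = restrict z R" for z :: "'a \<Rightarrow> 'b"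
    using assms(5) by (simp add: Int_absorb1)
  have pt: "slab X (insert n S) {n} (\<lambda>_. a) S ?k z
      = (if z \<in> PiE (insert n S) X \<and> z n = a \<and> (\<forall>i\<in>I - {n}. z i = u i) then f (restrict z R) else 0)" for a z
  proof -
    have "(\<forall>i\<in>I - {n}. restrict z S i = u i) \<longleftrightarrow> (\<forall>i\<in>I - {n}. z i = u i)"
      using assms(6) by (intro ball_cong) auto
    then show ?thesis using PiE_insert_restrict[of z n S X] unfolding slab_def rr by simp
  qed
  show "?h \<in> indep_ext (insert n S) X C"
  proof (cases "n \<in> I")
    case True
    then have "?h = slab X (insert n S) {n} (\<lambda>_. u n) S ?k"
      unfolding pt[abs_def] by (auto simp: slab_def fun_eq_iff)
    then show ?thesis using ext[of "u n"] assms(7) True by auto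
  next
    case False
    \<comment> \<open>The values of coordinate \<open>n\<close> partition the product space. Since
      \<open>X n\<close> is nonempty, the sum has a term and stays in the extension.\<close>
    have "?h = (\<lambda>z. \<Sum>a\<in>X n. slab X (insert n S) {n} (\<lambda>_. a) S ?k z)"
    proof
      fix z
      have "(\<Sum>a\<in>X n. slab X (insert n S) {n} (\<lambda>_. a) S ?k z) = (\<Sum>a\<in>X n. if z n = a then ?h z else 0)"
        unfolding pt using False by (intro sum.cong) (auto simp: slab_def)
      also have "\<dots> = ?h z" using n(2) by (auto simp: slab_def PiE_iff)
      finally show "?h z = (\<Sum>a\<in>X n. slab X (insert n S) {n} (\<lambda>_. a) S ?k z)" by simp
    qed
    then show ?thesis using indep_ext_sum[OF n(2,3) ext] by simp
  qed
next
  assume "?h \<in> indep_ext (insert n S) X C"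
  then obtain p where p: "\<And>a. a \<in> X n \<Longrightarrow> p a > 0" and int: "integrate_out X n S p ?h \<in> indep_ext S X C"
    using indep_ext_integrate_out[of n S X C, OF n] by blast
  \<comment> \<open>The mass that \<open>p\<close> gives to the values of coordinate
    \<open>n\<close> allowed by the slab.\<close>
  define r where "r = (if n \<in> I then p (u n) else \<Sum>a\<in>X n. p a)"
  have "r > 0" unfolding r_def using p n(2,3) assms(7) by (auto intro!: sum_pos)
  have "integrate_out X n S p ?h = (\<lambda>z. r * ?k z)"
  proof
    fix z
    show "integrate_out X n S p ?h z = r * ?k z"
    proof (cases "z \<in> PiE S X")
      case True
      have restr: "restrict (z(n := a)) R = restrict z R" for a
        using n(1) assms(5) by (auto simp: fun_eq_iff restrict_def)
      have all: "(\<forall>i\<in>I. (z(n := a)) i = u i) \<longleftrightarrow> (n \<in> I \<longrightarrow> a = u n) \<and> (\<forall>i\<in>I - {n}. z i = u i)" for a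
        by auto
      have "(\<Sum>a\<in>X n. p a * ?h (z(n := a))) = (\<Sum>a\<in>X n. (if n \<in> I \<longrightarrow> a = u n then p a else 0) * ?k z)"
        using True PiE_insert_upd[OF True] unfolding slab_def restr all
        by (intro sum.cong) auto
      also have "\<dots> = r * ?k z"
        using n(2) assms(7) unfolding sum_distrib_right[symmetric] r_def by (auto simp: Pi_iff)
      finally show ?thesis using True by (simp add: integrate_out_def)
    qed (simp add: integrate_out_def slab_def)
  qed
  then show "?k \<in> indep_ext S X C" using int indep_ext_scale_iff[OF \<open>r > 0\<close>] by metis
qed

text \<open>Induction on \<open>J\<close> with \<open>I\<close> arbitrary, since each step also
  removes \<open>n\<close> from \<open>I\<close>. This equivalence later yields coherence, marginals
  and independence.\<close>

lemma indep_ext_slab_iff: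
  assumes "finite J" "J \<inter> R = {}" "I \<subseteq> J" "u \<in> Pi I X" "f \<in> gambles (PiE R X)"
    and "\<And>n. n \<in> J \<Longrightarrow> finite (X n) \<and> X n \<noteq> {} \<and> coherent (X n) (C n)"
  shows "slab X (R \<union> J) I u R f \<in> indep_ext (R \<union> J) X C \<longleftrightarrow> f \<in> indep_ext R X C"
  using assms
proof (induction J arbitrary: I rule: finite_induct)
  case empty
  \<comment> \<open>With no coordinate left to eliminate the slab is \<open>f\<close> itself, as
    \<open>f\<close> vanishes off \<open>PiE R X\<close>.\<close>
  have "restrict z R = z" if "z \<in> PiE R X" for z
    using that by (auto simp: fun_eq_iff restrict_def PiE_def extensional_def)
  then have "slab X R I u R f = f" using empty by (auto simp: slab_def gambles_def fun_eq_iff)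
  then show ?case by simp
next
  case (insert n J)
  then have "slab X (insert n (R \<union> J)) I u R f \<in> indep_ext (insert n (R \<union> J)) X C
      \<longleftrightarrow> slab X (R \<union> J) (I - {n}) u R f \<in> indep_ext (R \<union> J) X C"
    by (intro indep_ext_slab_step) auto
  also have "\<dots> \<longleftrightarrow> f \<in> indep_ext R X C"
    using insert.prems by (intro insert.IH) auto
  finally show ?case by simp
qed


section \<open>Independence and minimality\<close>

lemma cyl_eq_slab: "cyl X R N f = slab X N {} u R f"
  by (auto simp: cyl_def slab_def)

lemma ind_times_eq_slab:
  assumes "I \<subseteq> N" "R \<subseteq> N - I" "u \<in> PiE I X"
  shows "ind_times X N I u (cyl X R (N - I) f) = slab X N I u R f"
proof
  fix z
  show "ind_times X N I u (cyl X R (N - I) f) z = slab X N I u R f z"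
  proof (cases "z \<in> PiE N X")
    case True
    then have "restrict z (N - I) \<in> PiE (N - I) X" by auto
    moreover have "restrict (restrict z (N - I)) R = restrict z R"
      using assms(2) by (simp add: Int_absorb1)
    ultimately show ?thesis using True restrict_eq_iff[OF assms(3), of z]
      by (simp add: ind_times_def cyl_def slab_def indicator_def)
  qed (simp add: ind_times_def cyl_def slab_def)
qed

lemma marg_conditional_eq:
  assumes "I \<subseteq> N" "R \<subseteq> N - I" "u \<in> PiE I X"
  shows "marg X (N - I) R (conditional X N I u D) = {f \<in> gambles (PiE R X). slab X N I u R f \<in> D}"
  unfolding marg_def conditional_def ind_times_eq_slab[OF assms, symmetric]
  by (auto simp: gambles_def cyl_def)

text \<open>The end point of the elimination: no coordinates means no slices, and positive gambles
  are closed under the remaining operations.\<close>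

lemma indep_ext_empty: "indep_ext {} X C \<subseteq> pos_gambles (PiE {} X)"
proof
  fix f assume "f \<in> indep_ext {} X C"
  then show "f \<in> pos_gambles (PiE {} X)"
    by (induction rule: indep_ext_induct) (auto simp: pos_gambles_iff)
qed

lemma indep_ext_singleton:
  fixes X :: "'n \<Rightarrow> 'a set"
  assumes "coherent (X n) (C n)"
  shows "indep_ext {n} X C = local_gamble X n ` C n"
proof
  have slice_eq: "slice_gamble X {n} n x g = local_gamble X n g" for x g
    by (auto simp: slice_gamble_def local_gamble_def)
  show "indep_ext {n} X C \<subseteq> local_gamble X n ` C n"
  proof
    fix f assume "f \<in> indep_ext {n} X C"
    then show "f \<in> local_gamble X n ` C n"
    proof (induction rule: indep_ext_induct)
      case (pos f)
      \<comment> \<open>\<open>pt\<close> is the bijection from \<open>X n\<close> onto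
        \<open>PiE {n} X\<close>; pulling \<open>f\<close> back along it gives \<open>g\<close>,
        which lies in \<open>C n\<close> because coherent sets contain all positive gambles.\<close>
      define pt where "pt a = (\<lambda>i. if i = n then a else undefined)" for a :: 'a
      define g where "g a = (if a \<in> X n then f (pt a) else 0)" for a
      have pt: "z = pt (z n)" "z n \<in> X n" if "z \<in> PiE {n} X" for z
        using that by (auto simp: pt_def PiE_def extensional_def fun_eq_iff)
      have pt_in: "pt a \<in> PiE {n} X" if "a \<in> X n" for a
        using that by (auto simp: pt_def PiE_def extensional_def)
      have f: "\<And>z. z \<notin> PiE {n} X \<Longrightarrow> f z = 0" "\<And>z. z \<in> PiE {n} X \<Longrightarrow> f z \<ge> 0" "\<exists>z\<in>PiE {n} X. f z > 0"
        using pos unfolding pos_gambles_iff by blast+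
      have "f = local_gamble X n g"
      proof
        fix z show "f z = local_gamble X n g z"
          using pt[of z] f(1)[of z] by (cases "z \<in> PiE {n} X") (simp_all add: local_gamble_def g_def)
      qed
      moreover have "g \<in> pos_gambles (X n)"
        unfolding pos_gambles_iff
      proof (intro conjI)
        obtain z where "z \<in> PiE {n} X" "f z > 0" using f(3) by blast
        then show "\<exists>a\<in>X n. g a > 0" using pt[of z] by (intro bexI[of _ "z n"]) (auto simp: g_def)
      qed (use f(2) pt_in in \<open>auto simp: g_def\<close>)
      ultimately show ?case using assms by (auto simp: coherent_def)
    next
      case (slice m x g)
      then show ?case by (simp add: slice_eq)
    next
      case (scale f r)
      then obtain g where "g \<in> C n" "f = local_gamble X n g" by auto
      then show ?case using coherent_scale[OF assms, of g r] scale
        by (intro image_eqI[of _ _ "\<lambda>z. r * g z"]) (auto simp: local_gamble_def)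
    next
      case (add f f')
      then obtain g g' where "g \<in> C n" "f = local_gamble X n g" "g' \<in> C n" "f' = local_gamble X n g'" by auto
      then show ?case using coherent_add[OF assms, of g g']
        by (intro image_eqI[of _ _ "\<lambda>z. g z + g' z"]) (auto simp: local_gamble_def)
    qed
  qed
  show "local_gamble X n ` C n \<subseteq> indep_ext {n} X C"
    \<comment> \<open>The constantly \<open>undefined\<close> function is the only point of
      \<open>PiE {} X\<close>.\<close>
    using indep_ext_slice[of n "{n}" "\<lambda>_. undefined" X _ C] by (auto simp: slice_eq)
qed

lemma indep_ext_coherent:
  assumes "finite N" "\<And>n. n \<in> N \<Longrightarrow> finite (X n) \<and> X n \<noteq> {} \<and> coherent (X n) (C n)"
  shows "coherent (PiE N X) (indep_ext N X C)"
  unfolding coherent_def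
proof (intro conjI)
  \<comment> \<open>Eliminating all coordinates turns the zero gamble into the zero gamble on a
    one-point space, where it is not positive.\<close>
  have "slab X ({} \<union> N) {} (\<lambda>_. undefined) {} (\<lambda>_. 0) \<in> indep_ext ({} \<union> N) X C
      \<longleftrightarrow> (\<lambda>_. 0) \<in> indep_ext {} X C"
    using assms by (intro indep_ext_slab_iff) (auto simp: gambles_def)
  moreover have "(\<lambda>_. 0) \<notin> indep_ext {} X C"
    using indep_ext_empty[of X C] by (auto simp: pos_gambles_def)
  ultimately show "(\<lambda>_. 0) \<notin> indep_ext N X C" by (simp add: slab_def)
  show "posi (indep_ext N X C) = indep_ext N X C" unfolding indep_ext_def by (rule posi_posi)
qed (auto intro: indep_ext_pos indep_ext_gambles)

lemma cond_indep_product_indep_ext: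
  assumes "finite N"
    and "\<And>n. n \<in> N \<Longrightarrow> finite (X n)" and "\<And>n. n \<in> N \<Longrightarrow> X n \<noteq> {}"
    and "\<And>n y. n \<in> N \<Longrightarrow> y \<in> Y \<Longrightarrow> coherent (X n) (Dn n y)"
  shows "cond_indep_product N X Y Dn (\<lambda>y. indep_ext N X (\<lambda>n. Dn n y))"
  unfolding cond_indep_product_def
proof (intro ballI conjI allI impI)
  fix y assume y: "y \<in> Y"
  let ?C = "\<lambda>n. Dn n y" and ?E = "indep_ext N X (\<lambda>n. Dn n y)"
  show "coherent (PiE N X) ?E" using assms y by (intro indep_ext_coherent) auto
  \<comment> \<open>The right-hand side depends on neither \<open>I\<close> nor \<open>u\<close>:
    this is the independence condition, with \<open>I = {}\<close> giving the marginal.\<close>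
  have slab: "{f \<in> gambles (PiE R X). slab X N I u R f \<in> ?E} = indep_ext R X ?C"
    if "R \<subseteq> N - I" "I \<subseteq> N" "u \<in> Pi I X" for R I u
  proof -
    have N: "R \<union> (N - R) = N" using that by auto
    have "slab X N I u R f \<in> ?E \<longleftrightarrow> f \<in> indep_ext R X ?C" if "f \<in> gambles (PiE R X)" for f
      using indep_ext_slab_iff[of "N - R" R I u X f ?C, unfolded N] that \<open>R \<subseteq> N - I\<close> \<open>I \<subseteq> N\<close> \<open>u \<in> Pi I X\<close> assms y
      by blast
    then show ?thesis using indep_ext_gambles by blast
  qed
  have marg: "marg X N R ?E = indep_ext R X ?C" if "R \<subseteq> N" for R
    unfolding marg_def cyl_eq_slab[where u = "\<lambda>_. undefined"] using that by (intro slab) auto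
  show "marg X N {n} ?E = local_gamble X n ` Dn n y" if "n \<in> N" for n
    using marg[of "{n}"] that indep_ext_singleton[of X n ?C] assms(4) y by auto
  show "marg X (N - I) R (conditional X N I u ?E) = marg X N R ?E"
    if "I \<subseteq> N \<and> R \<subseteq> N \<and> I \<inter> R = {}" "u \<in> PiE I X" for I R u
  proof -
    have "R \<subseteq> N - I" using that by auto
    then show ?thesis using that marg[of R] slab[of R I u]
      by (auto simp: marg_conditional_eq PiE_def)
  qed
qed

lemma indep_ext_least:
  assumes "cond_indep_product N X Y Dn D" "y \<in> Y"
  shows "indep_ext N X (\<lambda>n. Dn n y) \<subseteq> D y"
proof
  have coh: "coherent (PiE N X) (D y)"
    and marg: "\<And>n. n \<in> N \<Longrightarrow> marg X N {n} (D y) = local_gamble X n ` Dn n y"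
    and indep: "\<And>I R u. I \<subseteq> N \<Longrightarrow> R \<subseteq> N \<Longrightarrow> I \<inter> R = {} \<Longrightarrow> u \<in> PiE I X \<Longrightarrow>
      marg X (N - I) R (conditional X N I u (D y)) = marg X N R (D y)"
    using assms unfolding cond_indep_product_def by blast+
  fix f assume "f \<in> indep_ext N X (\<lambda>n. Dn n y)"
  then show "f \<in> D y"
  proof (induction rule: indep_ext_induct)
    case (pos f)
    then show ?case using coh by (auto simp: coherent_def)
  next
    case (slice n x g)
    have "local_gamble X n g \<in> marg X (N - (N - {n})) {n} (conditional X N (N - {n}) x (D y))"
      using indep[of "N - {n}" "{n}" x] marg[of n] slice by auto
    then have "slab X N (N - {n}) x {n} (local_gamble X n g) \<in> D y"
      using slice by (subst (asm) marg_conditional_eq) auto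
    moreover have "slab X N (N - {n}) x {n} (local_gamble X n g) = slice_gamble X N n x g"
      using slice(1) by (auto simp: slab_def slice_gamble_def local_gamble_def fun_eq_iff)
    ultimately show ?case by simp
  qed (auto intro: coherent_scale[OF coh] coherent_add[OF coh])
qed

theorem corollary31:
  fixes N :: "'n set" and X :: "'n \<Rightarrow> 'a set" and Y :: "'y set"
    and Dn :: "'n \<Rightarrow> 'y \<Rightarrow> ('a \<Rightarrow> real) set"
    and D :: "'y \<Rightarrow> (('n \<Rightarrow> 'a) \<Rightarrow> real) set"
  assumes "finite N" and "N \<noteq> {}"
    and "\<And>n. n \<in> N \<Longrightarrow> finite (X n)" and "\<And>n. n \<in> N \<Longrightarrow> X n \<noteq> {}"
    and "finite Y" and "Y \<noteq> {}"
    and "\<And>n y. n \<in> N \<Longrightarrow> y \<in> Y \<Longrightarrow> coherent (X n) (Dn n y)"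
  shows "smallest_cond_indep_product N X Y Dn D \<longleftrightarrow>
           (\<forall>y\<in>Y. D y = indep_ext N X (\<lambda>n. Dn n y))"
proof
  let ?E = "\<lambda>y. indep_ext N X (\<lambda>n. Dn n y)"
  have E: "cond_indep_product N X Y Dn ?E"
    using assms by (intro cond_indep_product_indep_ext) auto
  show "\<forall>y\<in>Y. D y = ?E y" if D: "smallest_cond_indep_product N X Y Dn D"
  proof
    fix y assume "y \<in> Y"
    then show "D y = ?E y"
      using D E indep_ext_least[of N X Y Dn D y] unfolding smallest_cond_indep_product_def by blast
  qed
  show "smallest_cond_indep_product N X Y Dn D" if "\<forall>y\<in>Y. D y = ?E y"
  proof -
    \<comment> \<open>The product conditions only inspect the family at points of \<open>Y\<close>,
      where \<open>D\<close> agrees with \<open>?E\<close>.\<close>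
    have "cond_indep_product N X Y Dn D"
      using E that unfolding cond_indep_product_def by simp
    then show ?thesis using that indep_ext_least[of N X Y Dn]
      unfolding smallest_cond_indep_product_def by auto
  qed
qed

end
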